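(* Let $\mathcal{K}(\mathbb{M}_2)\cong\mathbb{R}^6$ be the space of Killing $2$-tensors of the Minkowski plane with coordinates $(A,B,C,\alpha,\beta,\gamma)$, and let $G_M$, $R_0,R_1$, $S_3,S_4,S_5$ be as defined in the context. The set $(S_3\cap S_4)\setminus S_5$ has four connected components. They are mapped one into the other by the two discrete transformations $R_0$ and $R_1$ (i.e. any component is mapped onto any other by some composition of these), hence they form a unique orbit of the action of $G_M$.
   Context: In the Minkowski plane $\mathbb{M}_2$ with pseudo-Cartesian coordinates $(t,x)$ and metric $\mathbf{g}$ with contravariant components $\mathrm{diag}(1,-1)$, the general Killing $2$-tensor has contravariant components $K^{11}=A+2\alpha x+\gamma x^2$, $K^{12}=K^{21}=C+\alpha t+\beta x+\gamma tx$, $K^{22}=B+2\beta t+\gamma t^2$, with $A,B,C,\alpha,\beta,\gamma\in\mathbb{R}$. So the vector space $\mathcal{K}(\mathbb{M}_2)$ of Killing $2$-tensors is identified with $\mathbb{R}^6$ with coordinates $(A,B,C,\alpha,\beta,\gamma)$. With respect to $(\partial_A,\partial_B,\partial_C,\partial_\alpha,\partial_\beta,\partial_\gamma)$ define the vector fields on $\mathcal{K}(\mathbb{M}_2)$: $V_1=(0,-2\beta,-\alpha,0,-\gamma,0)$ and $V_2=(-2\alpha,0,-\beta,-\gamma,0,0)$ (translations); $V_3=(2C,2C,A+B,\beta,\alpha,0)$ (boost); $V_4=(2A,2B,2C,\alpha,\beta,0)$ (dilatation of the plane); $V_5=(1,-1,0,0,0,0)$ (addition of a multiple of the metric); $V_6=(A,B,C,\alpha,\beta,\gamma)$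 (scalar multiplication). Discrete transformations of $\mathcal{K}(\mathbb{M}_2)$ (unlisted coordinates are unchanged): $R_0:\mathbf{K}\mapsto-\mathbf{K}$; $R_1: C\mapsto-C,\ \alpha\mapsto-\alpha$; $R_2: C\mapsto-C,\ \beta\mapsto-\beta$. $G_M$ is the group of transformations of $\mathcal{K}(\mathbb{M}_2)$ generated by the flows of $V_1,\dots,V_6$ and by $R_0,R_1,R_2$. $S_3=\{\gamma(A+B)=\alpha^2+\beta^2,\ \gamma C=\alpha\beta\}$; $S_4=\{\gamma=0,\ \alpha=\beta,\ A+B=2C\}\cup\{\gamma=0,\ \alpha=-\beta,\ A+B=-2C\}$; $S_5=\{\alpha=\beta=\gamma=0,\ B=-A,\ C=0\}$. *)

theory Defs
  imports "HOL-Analysis.Analysis" "HOL-Algebra.Generated_Groups" "HOL-Algebra.Group_Action"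
begin

(* A tuple (A, B, C, \<alpha>, \<beta>, \<gamma>) stands for the Killing 2-tensor K of the Minkowski plane whose
   contravariant components in pseudo-Cartesian coordinates (t, x), with metric diag(1, -1), are
     K11 = A + 2 \<alpha> x + \<gamma> x^2,  K12 = K21 = C + \<alpha> t + \<beta> x + \<gamma> t x,  K22 = B + 2 \<beta> t + \<gamma> t^2. *)
type_synonym killing2 = "real \<times> real \<times> real \<times> real \<times> real \<times> real"

fun V1 :: "killing2 \<Rightarrow> killing2" where
  "V1 (A, B, C, \<alpha>, \<beta>, \<gamma>) = (0, - 2 * \<beta>, - \<alpha>, 0, - \<gamma>, 0)"

fun V2 :: "killing2 \<Rightarrow> killing2" where
  "V2 (A, B, C, \<alpha>, \<beta>, \<gamma>) = (- 2 * \<alpha>, 0, - \<beta>, - \<gamma>, 0, 0)"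

fun V3 :: "killing2 \<Rightarrow> killing2" where
  "V3 (A, B, C, \<alpha>, \<beta>, \<gamma>) = (2 * C, 2 * C, A + B, \<beta>, \<alpha>, 0)"

fun V4 :: "killing2 \<Rightarrow> killing2" where
  "V4 (A, B, C, \<alpha>, \<beta>, \<gamma>) = (2 * A, 2 * B, 2 * C, \<alpha>, \<beta>, 0)"

fun V5 :: "killing2 \<Rightarrow> killing2" where
  "V5 (A, B, C, \<alpha>, \<beta>, \<gamma>) = (1, - 1, 0, 0, 0, 0)"

fun V6 :: "killing2 \<Rightarrow> killing2" where
  "V6 (A, B, C, \<alpha>, \<beta>, \<gamma>) = (A, B, C, \<alpha>, \<beta>, \<gamma>)"

fun R0 :: "killing2 \<Rightarrow> killing2" where
  "R0 (A, B, C, \<alpha>, \<beta>, \<gamma>) = (- A, - B, - C, - \<alpha>, - \<beta>, - \<gamma>)"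

fun R1 :: "killing2 \<Rightarrow> killing2" where
  "R1 (A, B, C, \<alpha>, \<beta>, \<gamma>) = (A, B, - C, - \<alpha>, \<beta>, \<gamma>)"

fun R2 :: "killing2 \<Rightarrow> killing2" where
  "R2 (A, B, C, \<alpha>, \<beta>, \<gamma>) = (A, B, - C, \<alpha>, - \<beta>, \<gamma>)"

(* The fields V1, ..., V6 are affine, hence complete, so each has exactly one global flow,
   and its time-t maps are bijections. *)
definition is_flow :: "('a::real_normed_vector \<Rightarrow> 'a) \<Rightarrow> (real \<Rightarrow> 'a \<Rightarrow> 'a) \<Rightarrow> bool" where
  "is_flow V \<Phi> \<longleftrightarrow>
     (\<forall>K. \<Phi> 0 K = K \<and> (\<forall>t. ((\<lambda>s. \<Phi> s K) has_vector_derivative V (\<Phi> t K)) (at t)))"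

definition flow_maps :: "('a::real_normed_vector \<Rightarrow> 'a) \<Rightarrow> ('a \<Rightarrow> 'a) set" where
  "flow_maps V = {\<Phi> t | \<Phi> t. is_flow V \<Phi>}"

definition generated_transformations :: "('a \<Rightarrow> 'a) set \<Rightarrow> ('a \<Rightarrow> 'a) monoid" where
  "generated_transformations H = (BijGroup UNIV)\<lparr>carrier := generate (BijGroup UNIV) H\<rparr>"

definition G\<^sub>M :: "(killing2 \<Rightarrow> killing2) monoid" where
  "G\<^sub>M = generated_transformations
     ((\<Union>V\<in>{V1, V2, V3, V4, V5, V6}. flow_maps V) \<union> {R0, R1, R2})"

definition S3 :: "killing2 set" where
  "S3 = {(A, B, C, \<alpha>, \<beta>, \<gamma>). \<gamma> * (A + B) = \<alpha>\<^sup>2 + \<beta>\<^sup>2 \<and> \<gamma> * C = \<alpha> * \<beta>}"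

definition S4 :: "killing2 set" where
  "S4 = {(A, B, C, \<alpha>, \<beta>, \<gamma>). \<gamma> = 0 \<and> \<alpha> = \<beta> \<and> A + B = 2 * C} \<union>
        {(A, B, C, \<alpha>, \<beta>, \<gamma>). \<gamma> = 0 \<and> \<alpha> = - \<beta> \<and> A + B = - 2 * C}"

definition S5 :: "killing2 set" where
  "S5 = {(A, B, C, \<alpha>, \<beta>, \<gamma>). \<alpha> = 0 \<and> \<beta> = 0 \<and> \<gamma> = 0 \<and> B = - A \<and> C = 0}"

end

theory Submission
  imports Defs
begin

text \<open>On \<open>S4\<close> we have \<open>\<gamma> = 0\<close>, so the first equation of \<open>S3\<close> reads \<open>\<alpha>\<^sup>2 + \<beta>\<^sup>2 = 0\<close> and
  forces \<open>\<alpha> = \<beta> = 0\<close>. What is left is the pair of planes \<open>A + B = \<plusminus> 2 C\<close> in the space of the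
  coordinates \<open>(A, B, C)\<close>, and \<open>S5\<close> is the line \<open>A + B = C = 0\<close> in which they meet. Removing
  this line cuts each plane into two open half-planes, and the four half-planes are told apart by
  the signs of \<open>A + B\<close> and \<open>C\<close>. They are connected and relatively open, hence they are the
  components (\<open>components_eq_open_partition\<close>). The transformation \<open>R0\<close> changes both signs and
  \<open>R1\<close> only that of \<open>C\<close>, so all four pairs of signs are reached.

  The locus is invariant under the whole group because through each of its points there is, for
  each of the six fields, an explicit integral curve that stays in the locus. The fields are
  Lipschitz, so integral curves are unique (\<open>integral_curve_unique\<close>) and every flow must follow
  these curves; uniqueness also makes time-\<open>t\<close> maps invertible, with the time-\<open>(-t)\<close> maps as
  inverses, so that products and inverses in the group of bijections are the expected ones.

  The group is transitive on the locus: scalar multiplication (\<open>V6\<close>) takes \<open>(1, 1, 1, 0, 0, 0)\<close>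
  to any prescribed \<open>C > 0\<close>, adding a multiple of the metric (\<open>V5\<close>) then moves it along the
  line \<open>A + B = 2 C\<close>, and the discrete transformations carry this half-plane to the others.\<close>

section \<open>Integral curves of Lipschitz vector fields\<close>

definition integral_curve :: "('a::real_normed_vector \<Rightarrow> 'a) \<Rightarrow> (real \<Rightarrow> 'a) \<Rightarrow> bool" where
  "integral_curve V x \<longleftrightarrow> (\<forall>t. (x has_vector_derivative V (x t)) (at t))"

text \<open>Gronwall's argument: the squared distance of two integral curves grows at most like
  \<open>exp (2 L t)\<close>, so it stays zero if it starts at zero.\<close>

lemma integral_curve_unique_forward:
  fixes V :: "'a::real_inner \<Rightarrow> 'a"
  assumes lip: "L-lipschitz_on UNIV V"
    and x: "integral_curve V x" and y: "integral_curve V y" and "x 0 = y 0" and "0 \<le> t"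
  shows "x t = y t"
proof -
  define u where "u s = exp (- 2 * L * s) * ((x s - y s) \<bullet> (x s - y s))" for s
  have "u t \<le> u 0"
  proof (rule DERIV_nonpos_imp_nonincreasing [OF \<open>0 \<le> t\<close>])
    fix s
    let ?d = "x s - y s" and ?w = "V (x s) - V (y s)"
    have "((\<lambda>s. x s - y s) has_vector_derivative ?w) (at s)"
      using x y by (auto simp: integral_curve_def intro!: has_vector_derivative_diff)
    then have d: "((\<lambda>s. x s - y s) has_derivative (\<lambda>h. h *\<^sub>R ?w)) (at s)"
      by (simp add: has_vector_derivative_def)
    have "((\<lambda>s. (x s - y s) \<bullet> (x s - y s)) has_derivative
        (\<lambda>h. ?d \<bullet> (h *\<^sub>R ?w) + (h *\<^sub>R ?w) \<bullet> ?d)) (at s)"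
      by (rule has_derivative_inner [OF d d])
    moreover have "(\<lambda>h. ?d \<bullet> (h *\<^sub>R ?w) + (h *\<^sub>R ?w) \<bullet> ?d) = (*) (2 * (?d \<bullet> ?w))"
      by (rule ext) (simp only: inner_scaleR_left inner_scaleR_right inner_commute [of ?w] mult_2
          distrib_left distrib_right mult.commute)
    ultimately have "((\<lambda>s. (x s - y s) \<bullet> (x s - y s)) has_real_derivative 2 * (?d \<bullet> ?w)) (at s)"
      by (simp add: has_field_derivative_def)
    note [derivative_intros] = this
    have "(u has_real_derivative 2 * exp (- 2 * L * s) * (?d \<bullet> ?w - L * (?d \<bullet> ?d))) (at s)"
      unfolding u_def by (rule derivative_eq_intros refl)+ (simp add: right_diff_distrib)
    moreover have "?d \<bullet> ?w \<le> L * (?d \<bullet> ?d)"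
    proof -
      have "?d \<bullet> ?w \<le> norm ?d * norm ?w"
        by (rule norm_cauchy_schwarz)
      also have "\<dots> \<le> norm ?d * (L * norm ?d)"
        using lipschitz_on_normD [OF lip, of "x s" "y s"] by (auto intro: mult_left_mono)
      also have "\<dots> = L * (?d \<bullet> ?d)"
        by (simp add: dot_square_norm power2_eq_square)
      finally show ?thesis .
    qed
    ultimately show "\<exists>z. (u has_real_derivative z) (at s) \<and> z \<le> 0"
      by (metis diff_le_0_iff_le exp_ge_zero mult_nonneg_nonpos mult_nonneg_nonneg zero_le_numeral)
  qed
  then have "(x t - y t) \<bullet> (x t - y t) \<le> 0"
    using \<open>x 0 = y 0\<close> by (simp add: u_def mult_le_0_iff not_le)
  then show ?thesis
    using inner_gt_zero_iff [of "x t - y t"] by fastforce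
qed

lemma integral_curve_reverse:
  assumes "integral_curve V x"
  shows "integral_curve (\<lambda>K. - V K) (\<lambda>s. x (- s))"
  unfolding integral_curve_def
proof
  fix t
  have "(x has_vector_derivative V (x (- t))) (at (- t))"
    using assms by (simp add: integral_curve_def)
  then have "((x \<circ> uminus) has_vector_derivative (- 1) *\<^sub>R V (x (- t))) (at t)"
    by (intro vector_diff_chain_at) (auto intro!: derivative_eq_intros)
  then show "((\<lambda>s. x (- s)) has_vector_derivative - V (x (- t))) (at t)"
    by (simp add: o_def)
qed

lemma integral_curve_shift:
  assumes "integral_curve V x"
  shows "integral_curve V (\<lambda>s. x (s + c))"
  unfolding integral_curve_def
proof
  fix t
  have "(x has_vector_derivative V (x (t + c))) (at (t + c))"
    using assms by (simp add: integral_curve_def)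
  then have "((x \<circ> (\<lambda>s. s + c)) has_vector_derivative 1 *\<^sub>R V (x (t + c))) (at t)"
    by (intro vector_diff_chain_at) (auto intro!: derivative_eq_intros)
  then show "((\<lambda>s. x (s + c)) has_vector_derivative V (x (t + c))) (at t)"
    by (simp add: o_def)
qed

lemma integral_curve_unique:
  fixes V :: "'a::real_inner \<Rightarrow> 'a"
  assumes lip: "L-lipschitz_on UNIV V"
    and x: "integral_curve V x" and y: "integral_curve V y" and eq: "x 0 = y 0"
  shows "x t = y t"
proof (cases "0 \<le> t")
  case True
  then show ?thesis
    using integral_curve_unique_forward [OF lip x y eq] by simp
next
  case False
  then show ?thesis
    using integral_curve_unique_forward [of L "\<lambda>K. - V K" "\<lambda>s. x (- s)" "\<lambda>s. y (- s)" "- t"]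
      lip eq integral_curve_reverse [OF x] integral_curve_reverse [OF y] by simp
qed

lemma is_flow_iff: "is_flow V \<Phi> \<longleftrightarrow> (\<forall>K. \<Phi> 0 K = K \<and> integral_curve V (\<lambda>s. \<Phi> s K))"
  by (simp add: is_flow_def integral_curve_def)

text \<open>Both \<open>s \<mapsto> \<Phi> s (\<Phi> t K)\<close> and \<open>s \<mapsto> \<Phi> (s + t) K\<close> are integral curves from
  \<open>\<Phi> t K\<close>; the second one is back at \<open>K\<close> for \<open>s = - t\<close>.\<close>

lemma flow_inverse:
  fixes V :: "'a::real_inner \<Rightarrow> 'a"
  assumes lip: "L-lipschitz_on UNIV V" and flow: "is_flow V \<Phi>"
  shows "\<Phi> (- t) (\<Phi> t K) = K"
proof -
  have "integral_curve V (\<lambda>s. \<Phi> s (\<Phi> t K))" "integral_curve V (\<lambda>s. \<Phi> (s + t) K)"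
    using flow by (auto simp: is_flow_iff intro: integral_curve_shift)
  from integral_curve_unique [OF lip this, of "- t"] show ?thesis
    using flow by (simp add: is_flow_iff)
qed

lemma flow_maps_bij:
  fixes V :: "'a::real_inner \<Rightarrow> 'a"
  assumes lip: "L-lipschitz_on UNIV V" and f: "f \<in> flow_maps V"
  shows "bij f"
proof -
  obtain \<Phi> t where flow: "is_flow V \<Phi>" and "f = \<Phi> t"
    using f by (auto simp: flow_maps_def)
  then show ?thesis
    using flow_inverse [OF lip flow, of t] flow_inverse [OF lip flow, of "- t"]
    by (intro o_bij [of "\<Phi> (- t)"]) (auto simp: fun_eq_iff)
qed

text \<open>To know that every flow preserves a set it suffices to find the integral curves inside that
  set, since no flow has a choice but to follow them. Equality rather than inclusion comes from
  running the flow backwards.\<close>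

lemma flow_maps_image_eq:
  fixes V :: "'a::real_inner \<Rightarrow> 'a"
  assumes lip: "L-lipschitz_on UNIV V" and f: "f \<in> flow_maps V"
    and curves: "\<And>K. K \<in> X \<Longrightarrow> \<exists>y. y 0 = K \<and> integral_curve V y \<and> range y \<subseteq> X"
  shows "f ` X = X"
proof -
  obtain \<Phi> t where flow: "is_flow V \<Phi>" and ft: "f = \<Phi> t"
    using f by (auto simp: flow_maps_def)
  have inX: "\<Phi> s K \<in> X" if K: "K \<in> X" for s K
  proof -
    obtain y where y: "y 0 = K" "integral_curve V y" "range y \<subseteq> X"
      using curves [OF K] by blast
    then have "\<Phi> s K = y s"
      using flow y integral_curve_unique [OF lip, of "\<lambda>s. \<Phi> s K" y s] by (simp add: is_flow_iff)
    then show ?thesis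
      using y by auto
  qed
  have "K \<in> f ` X" if "K \<in> X" for K
    using flow_inverse [OF lip flow, of "- t" K] inX [OF that, of "- t"] ft by force
  then show ?thesis
    using inX ft by auto
qed

section \<open>Groups generated by bijections\<close>

text \<open>\<open>BijGroup\<close> restricts its functions to the carrier and its product to bijections; over
  \<open>UNIV\<close> and for bijections these restrictions disappear.\<close>

lemma Bij_UNIV [simp]: "f \<in> Bij UNIV \<longleftrightarrow> bij f"
  by (simp add: Bij_def)

lemma carrier_generated_transformations [simp]:
  "carrier (generated_transformations H) = generate (BijGroup UNIV) H"
  by (simp add: generated_transformations_def)

lemma BijGroup_UNIV_carrier [simp]: "carrier (BijGroup UNIV) = {f. bij f}"
  by (auto simp: BijGroup_def)

lemma BijGroup_UNIV_one [simp]: "\<one>\<^bsub>BijGroup UNIV\<^esub> = id"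
  by (simp add: BijGroup_def restrict_def id_def)

lemma BijGroup_UNIV_mult [simp]:
  "bij f \<Longrightarrow> bij g \<Longrightarrow> f \<otimes>\<^bsub>BijGroup UNIV\<^esub> g = f \<circ> g"
  by (simp add: BijGroup_def compose_def restrict_def o_def)

lemma BijGroup_UNIV_inv [simp]:
  "bij f \<Longrightarrow> inv\<^bsub>BijGroup UNIV\<^esub> f = inv_into UNIV f"
  by (simp add: inv_BijGroup restrict_def)

lemma generate_BijGroup_bij:
  assumes "\<And>h. h \<in> H \<Longrightarrow> bij h" and "g \<in> generate (BijGroup UNIV) H"
  shows "bij g"
  using group.generate_in_carrier [OF group_BijGroup [of UNIV], of H g] assms by auto

lemma generate_BijGroup_id: "id \<in> generate (BijGroup UNIV) H"
  using generate.one [of "BijGroup UNIV" H] by simp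

lemma generate_BijGroup_comp:
  assumes H: "\<And>h. h \<in> H \<Longrightarrow> bij h"
    and f: "f \<in> generate (BijGroup UNIV) H" and g: "g \<in> generate (BijGroup UNIV) H"
  shows "f \<circ> g \<in> generate (BijGroup UNIV) H"
proof -
  have "bij f" "bij g"
    using generate_BijGroup_bij [OF H] f g by blast+
  then show ?thesis
    using generate.eng [OF f g] by simp
qed

text \<open>With \<open>h ` X = X\<close> instead of \<open>h ` X \<subseteq> X\<close> the invariance passes to inverses.\<close>

lemma generate_BijGroup_image_eq:
  assumes H: "\<And>h. h \<in> H \<Longrightarrow> bij h" and X: "\<And>h. h \<in> H \<Longrightarrow> h ` X = X"
    and g: "g \<in> generate (BijGroup UNIV) H"
  shows "g ` X = X"
  using g
proof induction
  case one
  then show ?case by simp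
next
  case (incl h)
  then show ?case by (rule X)
next
  case (inv h)
  have "inv_into UNIV h ` X = X"
    using H [OF inv] X [OF inv] by (metis bij_betw_imp_inj_on image_inv_f_f)
  then show ?case
    using H [OF inv] by simp
next
  case (eng f g)
  have "bij f" "bij g"
    using generate_BijGroup_bij [OF H] eng.hyps by blast+
  then show ?case
    by (simp only: BijGroup_UNIV_mult image_comp [symmetric] eng.IH)
qed

section \<open>Components of a disjoint union of relatively open connected sets\<close>

text \<open>A member of the partition is also relatively closed, its complement being the union of the
  other members. So it is clopen in the component that contains it, hence equal to it.\<close>

lemma components_eq_open_partition:
  assumes U: "\<Union>F = X" and disj: "disjoint F"
    and conn: "\<And>D. D \<in> F \<Longrightarrow> connected D" and ne: "{} \<notin> F"
    and op: "\<And>D. D \<in> F \<Longrightarrow> openin (top_of_set X) D"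
  shows "components X = F"
proof -
  have F_comp: "D \<in> components X" if D: "D \<in> F" for D
  proof -
    have "D \<subseteq> X" "D \<noteq> {}"
      using D U ne by auto
    then obtain C where C: "C \<in> components X" "D \<subseteq> C"
      using exists_component_superset [of D X] conn [OF D] by auto
    then have "C \<subseteq> X"
      by (simp add: in_components_subset)
    have "X - D = \<Union>(F - {D})"
      using U disj D by (auto simp: disjoint_def)
    then have "openin (top_of_set X) (X - D)"
      using op by auto
    then have "closedin (top_of_set X) D"
      using \<open>D \<subseteq> X\<close> by (simp add: closedin_def)
    then have "openin (top_of_set C) D" "closedin (top_of_set C) D"
      using op [OF D] \<open>D \<subseteq> C\<close> \<open>C \<subseteq> X\<close>
      by (auto intro: openin_subset_trans closedin_subset_trans)
    then have "D = C"
      using in_components_connected [OF C(1)] \<open>D \<noteq> {}\<close> by (auto simp: connected_clopen)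
    then show ?thesis
      using C by simp
  qed
  moreover have "C \<in> F" if C: "C \<in> components X" for C
  proof -
    obtain D where "D \<in> F" "C \<inter> D \<noteq> {}"
      using in_components_nonempty [OF C] in_components_subset [OF C] U by blast
    then show ?thesis
      using components_eq [OF C F_comp] by metis
  qed
  ultimately show ?thesis
    by blast
qed

section \<open>The four half-planes\<close>

text \<open>For \<open>p, q \<in> {1, - 1}\<close> these are the points of the plane \<open>A + B = 2 p q C\<close> at which
  \<open>A + B\<close> has sign \<open>p\<close> and \<open>C\<close> has sign \<open>q\<close>. Indexing by the two signs, and not by the plane
  and one sign, makes the discrete transformations act by sign changes of the indices.\<close>

definition half_plane :: "real \<Rightarrow> real \<Rightarrow> killing2 set" where
  "half_plane p q = {(A, B, C, \<alpha>, \<beta>, \<gamma>).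
     \<alpha> = 0 \<and> \<beta> = 0 \<and> \<gamma> = 0 \<and> p * (A + B) = 2 * (q * C) \<and> 0 < q * C}"

lemma mem_locus_iff:
  "(A, B, C, \<alpha>, \<beta>, \<gamma>) \<in> (S3 \<inter> S4) - S5 \<longleftrightarrow>
     \<alpha> = 0 \<and> \<beta> = 0 \<and> \<gamma> = 0 \<and> C \<noteq> 0 \<and> (\<exists>e \<in> {1, - 1}. A + B = 2 * e * C)"
  by (auto simp: S3_def S4_def S5_def)

lemma locus_eq: "(S3 \<inter> S4) - S5 = (\<Union>p \<in> {1, - 1}. \<Union>q \<in> {1, - 1}. half_plane p q)"
proof (intro Set.set_eqI)
  fix K :: killing2
  obtain A B C \<alpha> \<beta> \<gamma> where K: "K = (A, B, C, \<alpha>, \<beta>, \<gamma>)"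
    by (cases K) auto
  show "K \<in> (S3 \<inter> S4) - S5 \<longleftrightarrow> K \<in> (\<Union>p \<in> {1, - 1}. \<Union>q \<in> {1, - 1}. half_plane p q)"
    unfolding K mem_locus_iff by (auto simp: half_plane_def)
qed

text \<open>The parametrization by \<open>a = A\<close> and \<open>r = \<bar>C\<bar>\<close> exhibits a half-plane as a continuous image
  of a convex set.\<close>

lemma half_plane_eq_image:
  assumes "p \<in> {1, - 1}" and "q \<in> {1, - 1}"
  shows "half_plane p q = (\<lambda>(a, r). (a, 2 * p * r - a, q * r, 0, 0, 0)) ` (UNIV \<times> {0<..})"
proof (intro Set.set_eqI iffI)
  fix K assume "K \<in> half_plane p q"
  then obtain A B C where K: "K = (A, B, C, 0, 0, 0)" "p * (A + B) = 2 * (q * C)" "0 < q * C"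
    by (auto simp: half_plane_def)
  then have "K = (\<lambda>(a, r). (a, 2 * p * r - a, q * r, 0, 0, 0)) (A, q * C)"
    using assms by auto
  then show "K \<in> (\<lambda>(a, r). (a, 2 * p * r - a, q * r, 0, 0, 0)) ` (UNIV \<times> {0<..})"
    using K(3) by blast
qed (use assms in \<open>auto simp: half_plane_def\<close>)

lemma connected_half_plane:
  assumes "p \<in> {1, - 1}" and "q \<in> {1, - 1}"
  shows "connected (half_plane p q)"
  unfolding half_plane_eq_image [OF assms]
  by (intro connected_continuous_image convex_connected convex_Times)
    (auto intro!: continuous_intros simp: case_prod_beta)

text \<open>On the locus neither \<open>A + B\<close> nor \<open>C\<close> vanishes, so the conditions on their signs are open and
  already single out one half-plane.\<close>

lemma openin_half_plane:
  assumes "p \<in> {1, - 1}" and "q \<in> {1, - 1}"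
  shows "openin (top_of_set ((S3 \<inter> S4) - S5)) (half_plane p q)"
proof -
  let ?O = "{K :: killing2. 0 < p * (fst K + fst (snd K)) \<and> 0 < q * fst (snd (snd K))}"
  have "half_plane p q = ((S3 \<inter> S4) - S5) \<inter> ?O"
    using assms unfolding locus_eq by (auto simp: half_plane_def)
  moreover have "open ?O"
    by (intro open_Collect_conj open_Collect_less continuous_intros)
  ultimately show ?thesis
    by (simp add: openin_open_Int)
qed

lemma half_plane_signs:
  assumes "(A, B, C, \<alpha>, \<beta>, \<gamma>) \<in> half_plane p q" and "p \<in> {1, - 1}" and "q \<in> {1, - 1}"
  shows "p = sgn (A + B)" and "q = sgn C"
  using assms by (auto simp: half_plane_def)

lemma half_plane_disjnt:
  assumes "p \<in> {1, - 1}" "q \<in> {1, - 1}" "p' \<in> {1, - 1}" "q' \<in> {1, - 1}" "(p, q) \<noteq> (p', q')"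
  shows "half_plane p q \<inter> half_plane p' q' = {}"
proof (rule equals0I, elim IntE)
  fix K assume K: "K \<in> half_plane p q" "K \<in> half_plane p' q'"
  obtain A B C \<alpha> \<beta> \<gamma> where "K = (A, B, C, \<alpha>, \<beta>, \<gamma>)"
    by (cases K) auto
  with K have "p = sgn (A + B)" "q = sgn C" "p' = sgn (A + B)" "q' = sgn C"
    using half_plane_signs assms(1-4) by blast+
  then show False
    using assms(5) by simp
qed

lemma half_plane_nonempty:
  assumes "p \<in> {1, - 1}" "q \<in> {1, - 1}"
  shows "half_plane p q \<noteq> {}"
  using half_plane_eq_image [OF assms] by auto

lemma components_locus:
  "components ((S3 \<inter> S4) - S5) = case_prod half_plane ` ({1, - 1} \<times> {1, - 1})"
    (is "_ = ?F")
proof (rule components_eq_open_partition)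
  show "\<Union> ?F = (S3 \<inter> S4) - S5"
    unfolding locus_eq by auto
  show "disjoint ?F"
    unfolding disjoint_def
  proof (intro ballI impI)
    fix D E assume "D \<in> ?F" "E \<in> ?F" "D \<noteq> E"
    then obtain p q p' q' where "D = half_plane p q" "E = half_plane p' q'"
      "p \<in> {1, - 1}" "q \<in> {1, - 1}" "p' \<in> {1, - 1}" "q' \<in> {1, - 1}"
      by blast
    moreover from this have "(p, q) \<noteq> (p', q')"
      using \<open>D \<noteq> E\<close> by auto
    ultimately show "D \<inter> E = {}"
      using half_plane_disjnt by simp
  qed
  show "connected D" if "D \<in> ?F" for D
    using that connected_half_plane by force
  show "openin (top_of_set ((S3 \<inter> S4) - S5)) D" if "D \<in> ?F" for D
    using that openin_half_plane by force
  show "{} \<notin> ?F"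
  proof (rule notI, elim imageE SigmaE)
    fix K p q
    assume "{} = case_prod half_plane K" "K = (p, q)" "p \<in> {1, - 1}" "q \<in> {1, - 1}"
    then show False
      using half_plane_nonempty [of p q] by simp
  qed
qed

lemma component_locusE:
  assumes "X \<in> components ((S3 \<inter> S4) - S5)"
  obtains p q where "p \<in> {1, - 1}" "q \<in> {1, - 1}" "X = half_plane p q"
  using assms unfolding components_locus
proof (elim imageE SigmaE)
  fix K p q
  assume "X = case_prod half_plane K" "K = (p, q)" "p \<in> {1, - 1}" "q \<in> {1, - 1}"
  then show thesis
    using that [of p q] by simp
qed

lemma card_components_locus: "card (components ((S3 \<inter> S4) - S5)) = 4"
proof -
  have "inj_on (case_prod half_plane) ({1, - 1} \<times> {1, - 1})"
  proof (rule inj_onI, clarify)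
    fix p q p' q' :: real
    assume "p \<in> {1, - 1}" "q \<in> {1, - 1}" "p' \<in> {1, - 1}" "q' \<in> {1, - 1}"
      "half_plane p q = half_plane p' q'"
    then show "p = p' \<and> q = q'"
      using half_plane_disjnt half_plane_nonempty by (metis Int_absorb prod.inject)
  qed
  then show ?thesis
    by (simp add: components_locus card_image card_cartesian_product)
qed

section \<open>The discrete transformations permute the half-planes\<close>

lemma involutions: "R0 (R0 K) = K" "R1 (R1 K) = K" "R2 (R2 K) = K"
  by (cases K; simp)+

lemma bij_reflections: "bij R0" "bij R1" "bij R2"
  by (auto intro: involuntory_imp_bij simp: involutions)

lemma involution_image_eq:
  assumes "\<And>K. f (f K) = K" and "f ` S \<subseteq> T" and "f ` T \<subseteq> S"
  shows "f ` S = T"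
  using assms by (metis image_subset_iff rev_image_eqI subsetI subset_antisym)

lemma R0_half_plane: "R0 ` half_plane p q = half_plane (- p) (- q)"
  by (rule involution_image_eq [OF involutions(1)]) (auto simp: half_plane_def algebra_simps)

lemma R1_half_plane: "R1 ` half_plane p q = half_plane p (- q)"
  by (rule involution_image_eq [OF involutions(2)]) (auto simp: half_plane_def)

lemma R2_half_plane: "R2 ` half_plane p q = half_plane p (- q)"
  by (rule involution_image_eq [OF involutions(3)]) (auto simp: half_plane_def)

lemma reflections_locus:
  assumes "r \<in> {R0, R1, R2}"
  shows "r ` ((S3 \<inter> S4) - S5) = (S3 \<inter> S4) - S5"
  using assms unfolding locus_eq
  by (elim insertE emptyE)
    (simp_all add: image_Un R0_half_plane R1_half_plane R2_half_plane Un_ac)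

lemma half_planes_conjugate:
  assumes "p \<in> {1, - 1}" "q \<in> {1, - 1}" "p' \<in> {1, - 1}" "q' \<in> {1, - 1}"
  shows "\<exists>g \<in> generate (BijGroup UNIV) {R0, R1}. g ` half_plane p q = half_plane p' q'"
proof -
  let ?G = "generate (BijGroup UNIV) {R0, R1}"
  have mem: "id \<in> ?G" "R0 \<in> ?G" "R1 \<in> ?G" "R0 \<circ> R1 \<in> ?G"
    using generate_BijGroup_comp [of "{R0, R1}" R0 R1] bij_reflections
    by (auto intro: generate.incl generate_BijGroup_id)
  have "(p' = p \<or> p' = - p) \<and> (q' = q \<or> q' = - q)"
    using assms by auto
  then consider "p' = p" "q' = q" | "p' = - p" "q' = - q" | "p' = p" "q' = - q" | "p' = - p" "q' = q"
    by blast
  then show ?thesis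
  proof cases
    case 1
    then show ?thesis by (intro bexI [OF _ mem(1)]) simp
  next
    case 2
    then show ?thesis by (intro bexI [OF _ mem(2)]) (simp add: R0_half_plane)
  next
    case 3
    then show ?thesis by (intro bexI [OF _ mem(3)]) (simp add: R1_half_plane)
  next
    case 4
    have "(R0 \<circ> R1) ` half_plane p q = half_plane p' q'"
      using 4 by (simp only: image_comp [symmetric] R0_half_plane R1_half_plane minus_minus)
    then show ?thesis by (rule bexI [OF _ mem(4)])
  qed
qed

section \<open>The orbit\<close>

lemma linear_imp_lipschitz:
  fixes V :: "'a::euclidean_space \<Rightarrow> 'b::real_normed_vector"
  assumes "linear V"
  shows "\<exists>L. L-lipschitz_on UNIV V"
proof -
  interpret bounded_linear V
    using assms by (simp add: linear_conv_bounded_linear)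
  show ?thesis
    by (metis lipschitz_boundE)
qed

lemma lipschitz_V:
  assumes "V \<in> {V1, V2, V3, V4, V5, V6}"
  shows "\<exists>L. L-lipschitz_on UNIV V"
proof (cases "V = V5")
  case True
  then have "V = (\<lambda>K. (1, - 1, 0, 0, 0, 0))"
    by (auto simp: fun_eq_iff)
  then show ?thesis
    using lipschitz_on_constant by metis
next
  case False
  have "linear V1" "linear V2" "linear V3" "linear V4" "linear V6"
    by (rule linearI; clarsimp simp: algebra_simps)+
  then show ?thesis
    using assms False linear_imp_lipschitz by blast
qed

text \<open>On the locus \<open>\<alpha> = \<beta> = \<gamma> = 0\<close>, so \<open>V1\<close> and \<open>V2\<close> vanish there and the other fields have
  elementary integral curves within the plane \<open>A + B = 2 e C\<close>. Along all of them \<open>C\<close> is constant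
  or is multiplied by an exponential, hence it keeps away from zero.\<close>

lemma integral_curves_in_locus:
  assumes V: "V \<in> {V1, V2, V3, V4, V5, V6}" and K: "K \<in> (S3 \<inter> S4) - S5"
  shows "\<exists>y. y 0 = K \<and> integral_curve V y \<and> range y \<subseteq> (S3 \<inter> S4) - S5"
proof -
  obtain A B C where K_eq: "K = (A, B, C, 0, 0, 0)"
    using K by (cases K) (auto simp: mem_locus_iff simp del: Diff_iff Int_iff)
  then obtain e where e: "e \<in> {1, - 1}" "A + B = 2 * e * C" and C: "C \<noteq> 0"
    using K unfolding K_eq mem_locus_iff by (elim conjE bexE) (rule that)
  have curve: ?thesis
    if init: "a 0 = A" "b 0 = B" "c 0 = C"
      and deriv: "\<And>t. (a has_real_derivative a' t) (at t)" "\<And>t. (b has_real_derivative b' t) (at t)"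
        "\<And>t. (c has_real_derivative c' t) (at t)"
      and field: "\<And>t. V (a t, b t, c t, 0, 0, 0) = (a' t, b' t, c' t, 0, 0, 0)"
      and stays: "\<And>t. c t \<noteq> 0" "\<And>t. a t + b t = 2 * e * c t"
    for a b c a' b' c'
  proof -
    let ?y = "\<lambda>t. (a t, b t, c t, 0, 0, 0) :: killing2"
    have "?y 0 = K"
      by (simp add: K_eq init)
    moreover have "integral_curve V ?y"
      unfolding integral_curve_def field
      using deriv by (auto intro!: has_vector_derivative_Pair
          simp: has_real_derivative_iff_has_vector_derivative)
    moreover have "?y t \<in> (S3 \<inter> S4) - S5" for t
      unfolding mem_locus_iff using e(1) stays [of t] by blast
    ultimately show ?thesis
      by (intro exI [of _ ?y] conjI image_subsetI)
  qed
  consider "V = V1 \<or> V = V2" | "V = V3" | "V = V4" | "V = V5" | "V = V6"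
    using V by blast
  then show ?thesis
  proof cases
    case 1
    then show ?thesis
      using e C
      by (intro curve [of "\<lambda>t. A" "\<lambda>t. B" "\<lambda>t. C" "\<lambda>t. 0" "\<lambda>t. 0" "\<lambda>t. 0"]) auto
  next
    case 2
    \<comment> \<open>The boost: \<open>C' = A + B = 2 e C\<close> gives the exponential, and \<open>A' = B' = 2 C = e C'\<close>
      gives \<open>A\<close> and \<open>B\<close> up to constants.\<close>
    let ?c = "\<lambda>t. C * exp (2 * e * t)"
    have "e * e = 1"
      using e(1) by auto
    then have ee: "e * (2 * e * x) = 2 * x" for x
      by (metis mult.assoc mult.commute mult_1)
    have dc: "(?c has_real_derivative 2 * e * ?c t) (at t)" for t
      by (auto intro!: derivative_eq_intros)
    have da: "((\<lambda>t. D + e * (?c t - C)) has_real_derivative 2 * ?c t) (at t)" for D t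
      using DERIV_add [OF DERIV_const [of D]
          DERIV_cmult [OF DERIV_diff [OF dc DERIV_const [of C]], of e]]
      by (simp only: ee diff_0_right add_0_left)
    show ?thesis
      using 2 C e(2) by (intro curve [OF _ _ _ da [of A] da [of B] dc]) (auto simp: algebra_simps)
  next
    case 3
    then show ?thesis
      using e(2) C
      by (intro curve [of "\<lambda>t. A * exp (2 * t)" "\<lambda>t. B * exp (2 * t)" "\<lambda>t. C * exp (2 * t)"
            "\<lambda>t. 2 * (A * exp (2 * t))" "\<lambda>t. 2 * (B * exp (2 * t))" "\<lambda>t. 2 * (C * exp (2 * t))"])
        (auto intro!: derivative_eq_intros simp: distrib_right [symmetric])
  next
    case 4
    then show ?thesis
      using e(2) C
      by (intro curve [of "\<lambda>t. A + t" "\<lambda>t. B - t" "\<lambda>t. C" "\<lambda>t. 1" "\<lambda>t. - 1" "\<lambda>t. 0"])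
        (auto intro!: derivative_eq_intros)
  next
    case 5
    then show ?thesis
      using e(2) C
      by (intro curve [of "\<lambda>t. A * exp t" "\<lambda>t. B * exp t" "\<lambda>t. C * exp t"
            "\<lambda>t. A * exp t" "\<lambda>t. B * exp t" "\<lambda>t. C * exp t"])
        (auto intro!: derivative_eq_intros simp: distrib_right [symmetric])
  qed
qed

abbreviation generators_G\<^sub>M :: "(killing2 \<Rightarrow> killing2) set" where
  "generators_G\<^sub>M \<equiv> (\<Union>V\<in>{V1, V2, V3, V4, V5, V6}. flow_maps V) \<union> {R0, R1, R2}"

lemma bij_generators:
  assumes "h \<in> generators_G\<^sub>M"
  shows "bij h"
  using assms flow_maps_bij lipschitz_V bij_reflections by blast

lemma generators_locus:
  assumes "h \<in> generators_G\<^sub>M"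
  shows "h ` ((S3 \<inter> S4) - S5) = (S3 \<inter> S4) - S5"
  using assms
proof (elim UnE UN_E)
  fix V assume V: "V \<in> {V1, V2, V3, V4, V5, V6}" and "h \<in> flow_maps V"
  obtain L where "L-lipschitz_on UNIV V"
    using lipschitz_V [OF V] ..
  then show ?thesis
    using \<open>h \<in> flow_maps V\<close> integral_curves_in_locus [OF V] by (rule flow_maps_image_eq)
qed (rule reflections_locus)

lemma metric_flow:
  "(\<lambda>K. K + t *\<^sub>R (1, - 1, 0, 0, 0, 0)) \<in> flow_maps V5"
proof -
  have "V5 K = (1, - 1, 0, 0, 0, 0)" for K
    by (cases K) simp
  then have "is_flow V5 (\<lambda>t K. K + t *\<^sub>R (1, - 1, 0, 0, 0, 0))"
    unfolding is_flow_def
    by (auto intro!: derivative_eq_intros simp: zero_prod_def)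
  then show ?thesis
    unfolding flow_maps_def mem_Collect_eq by (intro exI conjI) (rule refl)
qed

lemma scaling_flow:
  "(\<lambda>K. exp t *\<^sub>R K) \<in> flow_maps V6"
proof -
  have "V6 K = K" for K
    by (cases K) simp
  moreover have "((\<lambda>s. exp s *\<^sub>R K) has_vector_derivative exp t *\<^sub>R K) (at t)"
    for t and K :: killing2
    by (auto intro!: derivative_eq_intros)
  ultimately have "is_flow V6 (\<lambda>t K. exp t *\<^sub>R K)"
    unfolding is_flow_def by simp
  then show ?thesis
    unfolding flow_maps_def mem_Collect_eq by (intro exI conjI) (rule refl)
qed

lemma reachable_half_plane:
  assumes "K \<in> half_plane 1 1"
  shows "\<exists>g \<in> generate (BijGroup UNIV) generators_G\<^sub>M. g (1, 1, 1, 0, 0, 0) = K"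
proof -
  obtain A B C where K: "K = (A, B, C, 0, 0, 0)" "A + B = 2 * C" "0 < C"
    using assms by (auto simp: half_plane_def)
  define f where "f = (\<lambda>K :: killing2. exp (ln C) *\<^sub>R K)"
  define g where "g = (\<lambda>K :: killing2. K + (A - C) *\<^sub>R (1, - 1, 0, 0, 0, 0))"
  have "f \<in> generators_G\<^sub>M" "g \<in> generators_G\<^sub>M"
    unfolding f_def g_def using metric_flow scaling_flow by blast+
  then have "g \<circ> f \<in> generate (BijGroup UNIV) generators_G\<^sub>M"
    by (intro generate_BijGroup_comp bij_generators generate.incl)
  moreover have "(g \<circ> f) (1, 1, 1, 0, 0, 0) = K"
    using K by (simp add: f_def g_def)
  ultimately show ?thesis
    by blast
qed

lemma locus_eq_orbit: "(S3 \<inter> S4) - S5 = orbit G\<^sub>M (\<lambda>g. g) (1, 1, 1, 0, 0, 0)"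
proof (intro subset_antisym subsetI)
  fix K assume "K \<in> (S3 \<inter> S4) - S5"
  then obtain p q :: real where pq: "p \<in> {1, - 1}" "q \<in> {1, - 1}" "K \<in> half_plane p q"
    unfolding locus_eq by blast
  obtain r where r: "r \<in> generate (BijGroup UNIV) {R0, R1}" "r ` half_plane 1 1 = half_plane p q"
    using half_planes_conjugate [of 1 1 p q] pq by auto
  then obtain K' where K': "K' \<in> half_plane 1 1" "K = r K'"
    using pq(3) by blast
  obtain g where g: "g \<in> generate (BijGroup UNIV) generators_G\<^sub>M" "g (1, 1, 1, 0, 0, 0) = K'"
    using reachable_half_plane [OF K'(1)] by blast
  have "r \<in> generate (BijGroup UNIV) generators_G\<^sub>M"
    using r(1) group.mono_generate [OF group_BijGroup, of "{R0, R1}" generators_G\<^sub>M] by blast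
  then have "r \<circ> g \<in> generate (BijGroup UNIV) generators_G\<^sub>M"
    using g(1) bij_generators by (intro generate_BijGroup_comp)
  moreover have "K = (r \<circ> g) (1, 1, 1, 0, 0, 0)"
    using g(2) K'(2) by simp
  ultimately show "K \<in> orbit G\<^sub>M (\<lambda>g. g) (1, 1, 1, 0, 0, 0)"
    unfolding orbit_def G\<^sub>M_def carrier_generated_transformations by blast
next
  fix K assume "K \<in> orbit G\<^sub>M (\<lambda>g. g) (1, 1, 1, 0, 0, 0)"
  then obtain g where g: "g \<in> generate (BijGroup UNIV) generators_G\<^sub>M" "K = g (1, 1, 1, 0, 0, 0)"
    unfolding orbit_def G\<^sub>M_def carrier_generated_transformations by blast
  have "g ` ((S3 \<inter> S4) - S5) = (S3 \<inter> S4) - S5"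
    using bij_generators generators_locus g(1) by (rule generate_BijGroup_image_eq)
  moreover have "(1, 1, 1, 0, 0, 0) \<in> (S3 \<inter> S4) - S5"
    by (simp add: mem_locus_iff del: Diff_iff Int_iff)
  ultimately show "K \<in> (S3 \<inter> S4) - S5"
    unfolding g(2) by blast
qed

theorem proposition27:
  shows "card (components ((S3 \<inter> S4) - S5)) = 4
    \<and> (\<forall>X \<in> components ((S3 \<inter> S4) - S5). \<forall>Y \<in> components ((S3 \<inter> S4) - S5).
         \<exists>g \<in> carrier (generated_transformations {R0, R1}). g ` X = Y)
    \<and> (S3 \<inter> S4) - S5 \<in> orbits G\<^sub>M UNIV (\<lambda>g. g)"
proof (intro conjI ballI)
  show "card (components ((S3 \<inter> S4) - S5)) = 4"
    by (rule card_components_locus)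
next
  fix X Y
  assume X: "X \<in> components ((S3 \<inter> S4) - S5)" and Y: "Y \<in> components ((S3 \<inter> S4) - S5)"
  obtain p q where "p \<in> {1, - 1}" "q \<in> {1, - 1}" "X = half_plane p q"
    using X by (rule component_locusE)
  moreover obtain p' q' where "p' \<in> {1, - 1}" "q' \<in> {1, - 1}" "Y = half_plane p' q'"
    using Y by (rule component_locusE)
  ultimately show "\<exists>g \<in> carrier (generated_transformations {R0, R1}). g ` X = Y"
    unfolding carrier_generated_transformations by (simp only: half_planes_conjugate)
next
  show "(S3 \<inter> S4) - S5 \<in> orbits G\<^sub>M UNIV (\<lambda>g. g)"
    unfolding orbits_def using locus_eq_orbit by blast
qed

end
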